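(* Let $k \geq 0$ be an integer. Every cylindrical semi-bar $k$-visibility graph is a $(k+2)$-quasiplanar convex geometric graph. More precisely, if $H$ has a cylindrical semi-bar $k$-visibility representation whose semi-bars in cyclic order around the cylinder are $b_1,\dots,b_n$, and $p_1,\dots,p_n$ are any points in convex position in the plane listed in cyclic order, then joining $p_i$ and $p_j$ by a straight segment exactly when the vertices of $b_i$ and $b_j$ are adjacent in $H$ produces a drawing with no $k+2$ pairwise crossing segments.
   Context: A cylindrical semi-bar $k$-visibility representation of a graph $G=(V,E)$ is a collection $\{s_v\}_{v\in V}$ of pairwise disjoint segments (semi-bars) in $\mathbb{R}^3$ parallel to the $x$-axis with left endpoints on the circle $\{(0,y,z): y^2+z^2=1\}$ (so they lie on the cylinder $y^2+z^2=1$), such that for all $a,b\in V$, $\{a,b\}\in E$ if and only if there is a circular arc on the surface of the cylinder lying in a plane parallel to the $yz$-plane (a sightline) which intersects $s_a$, $s_b$, and at most $k$ other semi-bars. A graph is a cylindrical semi-bar $k$-visibility graph if it has such a representation. A graph is $k$-quasiplanar if it can be drawn in the plane with no $k$ pairwise crossing edges; it is a $k$-quasiplanar convex geometric graph if it has such a drawing in which the vertices are points in convex position and edges are straight segments. *)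

theory Defs
  imports "HOL-Analysis.Analysis"
begin

definition simple_graph :: "'a set \<Rightarrow> 'a set set \<Rightarrow> bool" where
  "simple_graph V E \<longleftrightarrow> finite V \<and> (\<forall>e\<in>E. e \<subseteq> V \<and> card e = 2)"

definition semi_bar :: "(real \<times> real \<times> real) set \<Rightarrow> bool" where
  "semi_bar S \<longleftrightarrow>
     (\<exists>l y z. 0 < l \<and> y\<^sup>2 + z\<^sup>2 = 1 \<and> S = closed_segment (0, y, z) (l, y, z))"

text \<open>Sightlines are proper arcs. Admitting the full circle would not change which bars see
  each other, since a full circle meeting two bars contains a proper arc that still meets both.\<close>

definition sightline :: "(real \<times> real \<times> real) set \<Rightarrow> bool" where
  "sightline A \<longleftrightarrow>
     (\<exists>x \<alpha> \<beta>. \<alpha> < \<beta> \<and> \<beta> < \<alpha> + 2 * pi \<and> A = (\<lambda>t. (x, cos t, sin t)) ` {\<alpha>..\<beta>})"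

definition k_visible ::
    "nat \<Rightarrow> 'a set \<Rightarrow> ('a \<Rightarrow> (real \<times> real \<times> real) set) \<Rightarrow> 'a \<Rightarrow> 'a \<Rightarrow> bool" where
  "k_visible k V s a b \<longleftrightarrow>
     (\<exists>A. sightline A \<and> A \<inter> s a \<noteq> {} \<and> A \<inter> s b \<noteq> {} \<and>
          card {c \<in> V - {a, b}. A \<inter> s c \<noteq> {}} \<le> k)"

definition cylindrical_semi_bar_rep ::
    "nat \<Rightarrow> 'a set \<Rightarrow> 'a set set \<Rightarrow> ('a \<Rightarrow> (real \<times> real \<times> real) set) \<Rightarrow> bool" where
  "cylindrical_semi_bar_rep k V E s \<longleftrightarrow>
     (\<forall>v\<in>V. semi_bar (s v)) \<and>
     disjoint_family_on s V \<and>
     (\<forall>a\<in>V. \<forall>b\<in>V. a \<noteq> b \<longrightarrow> ({a, b} \<in> E \<longleftrightarrow> k_visible k V s a b))"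

definition cylindrical_semi_bar_graph :: "nat \<Rightarrow> 'a set \<Rightarrow> 'a set set \<Rightarrow> bool" where
  "cylindrical_semi_bar_graph k V E \<longleftrightarrow> (\<exists>s. cylindrical_semi_bar_rep k V E s)"

text \<open>The vertices \<open>w 0, \<dots>, w (n - 1)\<close> list all of \<open>V\<close> in the cyclic order of their bars around
  the cylinder, starting anywhere. The sign \<open>\<sigma>\<close> allows both senses of rotation.\<close>

definition bars_in_cyclic_order ::
    "'a set \<Rightarrow> ('a \<Rightarrow> (real \<times> real \<times> real) set) \<Rightarrow> nat \<Rightarrow> (nat \<Rightarrow> 'a) \<Rightarrow> bool" where
  "bars_in_cyclic_order V s n w \<longleftrightarrow>
     bij_betw w {..<n} V \<and>
     (\<exists>\<theta> \<sigma>. \<sigma> \<in> {1, - 1} \<and> strict_mono_on {..<n} \<theta> \<and>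
        (\<forall>i<n. \<theta> i < \<theta> 0 + 2 * pi \<and> (0, cos (\<theta> i), \<sigma> * sin (\<theta> i)) \<in> s (w i)))"

definition convex_position :: "(real \<times> real) set \<Rightarrow> bool" where
  "convex_position S \<longleftrightarrow> (\<forall>x\<in>S. x \<notin> convex hull (S - {x}))"

text \<open>Points in convex position are listed in cyclic order (in either sense) when each point and
  its cyclic successor span a side of the convex hull. Faces rather than edges of the hull are
  used so that the case \<open>n = 1\<close> needs no special treatment.\<close>

definition convex_position_in_cyclic_order :: "nat \<Rightarrow> (nat \<Rightarrow> real \<times> real) \<Rightarrow> bool" where
  "convex_position_in_cyclic_order n p \<longleftrightarrow>
     inj_on p {..<n} \<and> convex_position (p ` {..<n}) \<and>
     (\<forall>i<n. closed_segment (p i) (p (Suc i mod n)) face_of (convex hull (p ` {..<n})))"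

text \<open>The relative interior of a non-degenerate segment is the segment without its endpoints, so
  segments that only share an endpoint do not cross.\<close>

definition segments_cross :: "(real \<times> real) set \<Rightarrow> (real \<times> real) set \<Rightarrow> bool" where
  "segments_cross S T \<longleftrightarrow> rel_interior S \<inter> rel_interior T \<noteq> {}"

definition no_pairwise_crossing :: "nat \<Rightarrow> (real \<times> real) set set \<Rightarrow> bool" where
  "no_pairwise_crossing m D \<longleftrightarrow> \<not> (\<exists>F\<subseteq>D. card F = m \<and> pairwise segments_cross F)"

text \<open>When the vertices are in convex position, no edge passes through another vertex and no two
  edges overlap, so this need not be required of the drawing.\<close>

definition quasiplanar_convex_geometric :: "nat \<Rightarrow> 'a set \<Rightarrow> 'a set set \<Rightarrow> bool" where
  "quasiplanar_convex_geometric m V E \<longleftrightarrow>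
     (\<exists>p :: 'a \<Rightarrow> real \<times> real. inj_on p V \<and> convex_position (p ` V) \<and>
        no_pairwise_crossing m {closed_segment (p u) (p v) | u v. {u, v} \<in> E})"

end

theory Submission
  imports Defs
begin

text \<open>Suppose \<open>k + 2\<close> chords cross pairwise, and take a chord \<open>ab\<close> that has an endpoint whose bar
  is shortest among all the bars at endpoints of these chords. Any sightline meeting the bars of
  \<open>a\<close> and \<open>b\<close> lies at a height that every one of these bars reaches. Each of the other \<open>k + 1\<close>
  chords has one endpoint on either side of \<open>ab\<close>, so the sightline meets a bar of each of them,
  whichever way around the cylinder it goes. These bars are distinct, because crossing chords share
  no endpoint; hence \<open>a\<close> and \<open>b\<close> do not see each other.

  Sides of a chord are measured by signed areas. On the unit circle these factor into sines of half
  angles, which links sides of a chord to arcs. For arbitrary points in convex position, two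
  cyclically consecutive points cannot lie on different sides of a chord that avoids them, because
  the chord would cut a face of the convex hull.\<close>

section \<open>Orientation of point triples\<close>

text \<open>Twice the signed area of the triangle \<open>a\<close>, \<open>b\<close>,
  \<open>c\<close>: positive when \<open>c\<close> lies to the left of the line directed from
  \<open>a\<close> to \<open>b\<close>, zero when the points are collinear.\<close>

definition orient :: "real \<times> real \<Rightarrow> real \<times> real \<Rightarrow> real \<times> real \<Rightarrow> real" where
  "orient a b c = (fst b - fst a) * (snd c - snd a) - (snd b - snd a) * (fst c - fst a)"

lemma orient_same [simp]: "orient a b a = 0" "orient a b b = 0"
  by (simp_all add: orient_def)

lemma orient_swap: "orient b a c = - orient a b c"
  by (simp add: orient_def algebra_simps)

lemma orient_affine:
  "orient a b ((1 - t) *\<^sub>R c + t *\<^sub>R d) = (1 - t) * orient a b c + t * orient a b d"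
  by (simp add: orient_def algebra_simps)

text \<open>On the line through \<open>a\<close> and \<open>b\<close>, the parameter
  \<open>r\<close> of \<open>c\<close> tells which of the three points is between the other two. The
  middle case is an open segment because the definition of a face speaks of open segments.\<close>

lemma orient_eq_0_cases:
  assumes "orient a b c = 0" "a \<noteq> b"
  shows "a \<in> closed_segment c b \<or> c \<in> open_segment a b \<or> b \<in> closed_segment c a"
proof -
  obtain r where r: "c = (1 - r) *\<^sub>R a + r *\<^sub>R b"
  proof (cases "fst a = fst b")
    case True
    then have ne: "snd b - snd a \<noteq> 0" using assms(2) by (auto simp: prod_eq_iff)
    then have "fst c = fst a" using assms(1) True by (simp add: orient_def)
    moreover have "snd c = snd a + (snd c - snd a) / (snd b - snd a) * (snd b - snd a)"
      using ne by simp
    ultimately show ?thesis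
      using True
      by (intro that[of "(snd c - snd a) / (snd b - snd a)"])
         (simp add: prod_eq_iff left_diff_distrib right_diff_distrib)
  next
    case False
    then have ne: "fst b - fst a \<noteq> 0" by simp
    then have "snd c - snd a = (snd b - snd a) * (fst c - fst a) / (fst b - fst a)"
      using assms(1) by (simp add: orient_def field_simps)
    then have "snd c = snd a + (fst c - fst a) / (fst b - fst a) * (snd b - snd a)"
      by (simp add: algebra_simps)
    moreover have "fst c = fst a + (fst c - fst a) / (fst b - fst a) * (fst b - fst a)"
      using ne by simp
    ultimately show ?thesis
      by (intro that[of "(fst c - fst a) / (fst b - fst a)"])
         (simp add: prod_eq_iff left_diff_distrib right_diff_distrib)
  qed
  consider "r \<le> 0" | "0 < r" "r < 1" | "1 \<le> r" by linarith
  then show ?thesis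
  proof cases
    case 1
    \<comment> \<open>Solves \<open>a = (1 - s) *\<^sub>R c + s *\<^sub>R b\<close> for
      \<open>s\<close>; the case \<open>1 \<le> r\<close> does the same for
      \<open>b\<close>.\<close>
    define s where "s = - r / (1 - r)"
    have s: "0 \<le> s" "s \<le> 1" "(1 - s) * (1 - r) = 1" "(1 - s) * r + s = 0"
      using 1 by (auto simp: s_def field_simps)
    have "(1 - s) *\<^sub>R c + s *\<^sub>R b = ((1 - s) * (1 - r)) *\<^sub>R a + ((1 - s) * r + s) *\<^sub>R b"
      by (simp add: r algebra_simps)
    then have "a = (1 - s) *\<^sub>R c + s *\<^sub>R b" using s by simp
    then show ?thesis using s by (auto simp: in_segment)
  next
    case 2
    then show ?thesis using r assms(2) by (auto simp: in_segment)
  next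
    case 3
    define s where "s = (r - 1) / r"
    have s: "0 \<le> s" "s \<le> 1" "(1 - s) * r = 1" "(1 - s) * (1 - r) + s = 0"
      using 3 by (auto simp: s_def field_simps)
    have "(1 - s) *\<^sub>R c + s *\<^sub>R a = ((1 - s) * r) *\<^sub>R b + ((1 - s) * (1 - r) + s) *\<^sub>R a"
      by (simp add: r algebra_simps)
    then have "b = (1 - s) *\<^sub>R c + s *\<^sub>R a" using s by simp
    then show ?thesis using s by (auto simp: in_segment)
  qed
qed

text \<open>At a common interior point the affine function \<open>orient a b\<close> vanishes, and
  its value there is a mean of the values at \<open>c\<close> and \<open>d\<close> with positive
  weights. Both values being zero is the case of segments on one line.\<close>

lemma orient_crossing:
  assumes "segments_cross (closed_segment a b) (closed_segment c d)" "a \<noteq> b" "c \<noteq> d"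
  shows "(orient a b c = 0 \<and> orient a b d = 0) \<or> orient a b c * orient a b d < 0"
proof -
  obtain x where x: "x \<in> open_segment a b" "x \<in> open_segment c d"
    using assms by (auto simp: segments_cross_def rel_interior_closed_segment)
  obtain r where r: "x = (1 - r) *\<^sub>R a + r *\<^sub>R b"
    using x(1) by (auto simp: in_segment)
  obtain t where t: "0 < t" "t < 1" "x = (1 - t) *\<^sub>R c + t *\<^sub>R d"
    using x(2) by (auto simp: in_segment)
  have "orient a b x = 0"
    unfolding r orient_affine by simp
  then have eq: "(1 - t) * orient a b c + t * orient a b d = 0"
    unfolding t(3) orient_affine .
  show ?thesis
  proof (cases "orient a b c = 0")
    case True
    then show ?thesis using eq t by simp
  next
    case False
    \<comment> \<open>This is the equation \<open>eq\<close> multiplied by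
      \<open>orient a b c\<close>.\<close>
    have "t * (orient a b c * orient a b d) = - (1 - t) * (orient a b c)\<^sup>2"
      using eq by (simp add: power2_eq_square) algebra
    also have "\<dots> < 0" using False t by (simp add: mult_neg_pos)
    finally show ?thesis using t by (simp add: mult_less_0_iff)
  qed
qed

section \<open>Points in convex position\<close>

text \<open>The ends \<open>y\<close> and \<open>z\<close> may be any points of the hull, so that
  the intersection of a chord with a side of the polygon can serve as one of them.\<close>

lemma convex_position_notin_segment:
  assumes "convex_position S" "x \<in> S" "y \<in> convex hull (S - {x})" "z \<in> convex hull (S - {x})"
  shows "x \<notin> closed_segment y z"
  using assms closed_segment_subset_convex_hull[of y "S - {x}" z]
  unfolding convex_position_def by blast

lemma convex_position_not_collinear:
  assumes S: "convex_position S" and "a \<in> S" "b \<in> S" "c \<in> S" and ne: "a \<noteq> b" "c \<notin> {a, b}"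
  shows "orient a b c \<noteq> 0"
proof
  assume "orient a b c = 0"
  then consider "a \<in> closed_segment c b" | "c \<in> closed_segment a b" | "b \<in> closed_segment c a"
    using orient_eq_0_cases[OF _ ne(1)] segment_open_subset_closed by blast
  then show False
    using convex_position_notin_segment[OF S, of a c b] convex_position_notin_segment[OF S, of c a b]
      convex_position_notin_segment[OF S, of b c a] assms
    by cases (auto simp: hull_inc)
qed

text \<open>If \<open>c\<close> and \<open>d\<close> lay on opposite sides, the segment between them
  would meet the line through \<open>a\<close> and \<open>b\<close> in a point \<open>x\<close>.
  Convex position leaves only the possibility that \<open>x\<close> is strictly between
  \<open>a\<close> and \<open>b\<close>; the face containing \<open>x\<close> then contains
  \<open>a\<close>, which is impossible.\<close>

lemma convex_position_face_same_side:
  assumes S: "convex_position S" and mem: "a \<in> S" "b \<in> S" "c \<in> S" "d \<in> S"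
    and ne: "a \<noteq> b" "c \<notin> {a, b}" "d \<notin> {a, b}"
    and face: "closed_segment c d face_of (convex hull S)"
  shows "orient a b c * orient a b d > 0"
proof (rule ccontr)
  let ?f = "orient a b c" and ?g = "orient a b d"
  assume "\<not> ?f * ?g > 0"
  moreover have nz: "?f \<noteq> 0" "?g \<noteq> 0"
    using convex_position_not_collinear[OF S] mem ne by auto
  ultimately have neg: "?f * ?g < 0" by (metis linorder_neqE_linordered_idom mult_eq_0_iff)
  \<comment> \<open>The zero of the affine function that runs from \<open>?f\<close> at
    \<open>c\<close> to \<open>?g\<close> at \<open>d\<close>.\<close>
  define t where "t = ?f / (?f - ?g)"
  define x where "x = (1 - t) *\<^sub>R c + t *\<^sub>R d"
  have "?f \<noteq> ?g" using neg by (metis not_square_less_zero)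
  have t: "0 \<le> t" "t \<le> 1" "(1 - t) * ?f + t * ?g = 0"
    using neg \<open>?f \<noteq> ?g\<close> by (auto simp: t_def field_simps mult_less_0_iff zero_le_divide_iff)
  have x: "x \<in> closed_segment c d" using t unfolding x_def in_segment by blast
  have hull: "x \<in> convex hull (S - {a})" "x \<in> convex hull (S - {b})"
    using x closed_segment_subset_convex_hull[of c "S - {a}" d]
      closed_segment_subset_convex_hull[of c "S - {b}" d] mem ne
    by (auto intro: hull_inc)
  have "orient a b x = 0" using t(3) unfolding x_def orient_affine .
  then consider "a \<in> closed_segment x b" | "x \<in> open_segment a b" | "b \<in> closed_segment x a"
    using orient_eq_0_cases[OF _ ne(1)] by blast
  then show False
  proof cases
    case 1
    then show False
      using convex_position_notin_segment[OF S mem(1) hull(1), of b] mem ne by (auto intro: hull_inc)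
  next
    case 2
    have "a \<in> closed_segment c d"
      using face x 2 mem unfolding face_of_def by (blast intro: hull_inc)
    then show False
      using convex_position_notin_segment[OF S mem(1), of c d] mem ne by (auto intro: hull_inc)
  next
    case 3
    then show False
      using convex_position_notin_segment[OF S mem(2) hull(2), of a] mem ne by (auto intro: hull_inc)
  qed
qed

text \<open>Induction along the arc: each step follows a side of the hull that avoids both ends of
  the chord, so the sign persists. The indices are reduced only on use, which lets the arc wrap
  around past \<open>n - 1\<close>.\<close>

lemma convex_position_cyclic_arc_same_side:
  assumes p: "convex_position_in_cyclic_order n p" and ij: "i < n" "j < n" "i \<noteq> j"
    and "lo \<le> hi" and avoid: "\<And>m. lo \<le> m \<Longrightarrow> m \<le> hi \<Longrightarrow> m mod n \<noteq> i \<and> m mod n \<noteq> j"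
  shows "orient (p i) (p j) (p (lo mod n)) * orient (p i) (p j) (p (hi mod n)) > 0"
  using \<open>lo \<le> hi\<close> avoid
proof (induction hi rule: dec_induct)
  have inj: "inj_on p {..<n}" and S: "convex_position (p ` {..<n})"
    using p by (auto simp: convex_position_in_cyclic_order_def)
  have ne: "p i \<noteq> p j" using inj ij by (auto dest: inj_onD)
  have avoid_p: "p (m mod n) \<notin> {p i, p j}" if "m mod n \<noteq> i \<and> m mod n \<noteq> j" for m
    using that inj ij by (auto dest!: inj_onD)
  {
    case base
    then have "orient (p i) (p j) (p (lo mod n)) \<noteq> 0"
      using ij ne avoid_p[of lo] by (intro convex_position_not_collinear[OF S]) auto
    then show ?case by (simp add: zero_less_mult_iff) linarith
  next
    case (step m)
    have "closed_segment (p (m mod n)) (p (Suc m mod n)) face_of (convex hull (p ` {..<n}))"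
      using p ij unfolding convex_position_in_cyclic_order_def
      by (metis mod_Suc_eq mod_less_divisor gr_implies_not0 gr0I)
    then have "orient (p i) (p j) (p (m mod n)) * orient (p i) (p j) (p (Suc m mod n)) > 0"
      using ij ne avoid_p[of m] avoid_p[of "Suc m"] step.prems[of m] step.prems[of "Suc m"] step.hyps
      by (intro convex_position_face_same_side[OF S]) auto
    moreover have "orient (p i) (p j) (p (lo mod n)) * orient (p i) (p j) (p (m mod n)) > 0"
      using step.IH step.prems by simp
    ultimately show ?case by (auto simp: zero_less_mult_iff)
  }
qed

text \<open>The chord splits the remaining indices into two arcs, and the sign is constant on each;
  opposite signs therefore put \<open>u\<close> and \<open>v\<close> on different arcs.\<close>

lemma convex_position_cyclic_separates:
  assumes p: "convex_position_in_cyclic_order n p" and ij: "i < j" "j < n"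
    and uv: "u < n" "v < n"
    and opp: "orient (p i) (p j) (p u) * orient (p i) (p j) (p v) < 0"
  shows "(u \<in> {i<..<j} \<and> v \<in> {..<i} \<union> {j<..}) \<or> (v \<in> {i<..<j} \<and> u \<in> {..<i} \<union> {j<..})"
proof -
  let ?o = "\<lambda>m. orient (p i) (p j) (p m)"
  have inner: "?o a * ?o b > 0" if "a \<in> {i<..<j}" "b \<in> {i<..<j}" "a \<le> b" for a b
    using convex_position_cyclic_arc_same_side[OF p, of i j a b] that ij by auto
  \<comment> \<open>The outer arc runs through the indices \<open>j + 1, \<dots>, n + i - 1\<close> modulo \<open>n\<close>.\<close>
  have outer': "?o (a mod n) * ?o (b mod n) > 0" if "a \<in> {j<..<n + i}" "b \<in> {j<..<n + i}" "a \<le> b" for a b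
  proof (rule convex_position_cyclic_arc_same_side[OF p])
    fix m assume "a \<le> m" "m \<le> b"
    then show "m mod n \<noteq> i \<and> m mod n \<noteq> j"
      using that ij by (cases "m < n") (auto simp: not_less le_mod_geq)
  qed (use ij that in auto)
  \<comment> \<open>Lifting the indices below \<open>i\<close> by \<open>n\<close> turns the outer
    arc into a single interval.\<close>
  define g where "g = (\<lambda>m. if m < i then n + m else m)"
  have g: "g m \<in> {j<..<n + i}" "g m mod n = m" if "m \<in> {..<i} \<union> {j<..}" "m < n" for m
    using that ij by (auto simp: g_def)
  have outer: "?o a * ?o b > 0"
    if "a \<in> {..<i} \<union> {j<..}" "b \<in> {..<i} \<union> {j<..}" "a < n" "b < n" for a b
    using outer'[of "g a" "g b"] outer'[of "g b" "g a"] g[of a] g[of b] that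
    by (cases "g a \<le> g b") (auto simp: mult.commute)
  have "?o u \<noteq> 0" "?o v \<noteq> 0" using opp by auto
  then have "u \<notin> {i, j}" "v \<notin> {i, j}" by auto
  moreover have "\<not> (u \<in> {i<..<j} \<and> v \<in> {i<..<j})"
    using inner[of u v] inner[of v u] opp by (cases "u \<le> v") (auto simp: mult.commute)
  moreover have "\<not> (u \<in> {..<i} \<union> {j<..} \<and> v \<in> {..<i} \<union> {j<..})"
    using outer[of u v] uv opp by force
  ultimately show ?thesis by (auto simp: not_less le_less)
qed

section \<open>Points on the unit circle\<close>

text \<open>The area becomes a product, so its sign can be read off factor by factor. In the half
  differences \<open>u\<close> and \<open>w\<close> the double-angle formulas reduce the identity to
  algebra.\<close>

lemma orient_circle:
  "orient (cos a, sin a) (cos b, sin b) (cos c, sin c) =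
    4 * sin ((b - a) / 2) * sin ((c - a) / 2) * sin ((c - b) / 2)"
proof -
  define u w where "u = (b - a) / 2" and "w = (c - b) / 2"
  have uw: "b - a = 2 * u" "c - b = 2 * w" "c - a = 2 * u + 2 * w" "(c - a) / 2 = u + w"
    by (simp_all add: u_def w_def field_simps)
  have "orient (cos a, sin a) (cos b, sin b) (cos c, sin c) =
      sin (c - b) + sin (b - a) - sin (c - a)"
    by (simp add: orient_def sin_diff algebra_simps)
  also have "\<dots> = sin (2 * w) + sin (2 * u) - (sin (2 * u) * cos (2 * w) + cos (2 * u) * sin (2 * w))"
    unfolding uw sin_add ..
  also have "\<dots> = 4 * sin u * sin (u + w) * sin w"
    unfolding cos_double_sin sin_double sin_add by (simp add: power2_eq_square algebra_simps)
  finally show ?thesis unfolding uw(4) unfolding u_def w_def .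
qed

lemma sgn_sin_half:
  assumes "\<bar>x\<bar> < 2 * pi"
  shows "sgn (sin (x / 2)) = sgn x"
proof (cases x "0 :: real" rule: linorder_cases)
  case less
  then show ?thesis using assms sin_gt_zero[of "- x / 2"] by simp
next
  case greater
  then show ?thesis using assms sin_gt_zero[of "x / 2"] by simp
qed simp

text \<open>Each half difference lies strictly between \<open>- pi\<close> and \<open>pi\<close>,
  where sine has the sign of its argument. Orientation on the circle is thus decided by the order of
  the angles.\<close>

lemma sgn_orient_circle:
  assumes "\<bar>b - a\<bar> < 2 * pi" "\<bar>c - a\<bar> < 2 * pi" "\<bar>c - b\<bar> < 2 * pi"
  shows "sgn (orient (cos a, sin a) (cos b, sin b) (cos c, sin c)) =
    sgn (b - a) * sgn (c - a) * sgn (c - b)"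
  unfolding orient_circle sgn_mult using assms by (simp add: sgn_sin_half)

text \<open>Measuring several angles from the same start \<open>a\<close> keeps their differences
  below a full turn, as \<open>sgn_orient_circle\<close> requires.\<close>

lemma circle_angle_from:
  fixes q :: "real \<times> real"
  assumes "(fst q)\<^sup>2 + (snd q)\<^sup>2 = 1"
  obtains t where "a \<le> t" "t < a + 2 * pi" "q = (cos t, sin t)"
proof -
  obtain t where t: "fst q = cos t" "snd q = sin t"
    using assms by (metis sincos_total_2pi)
  define m where "m = \<lfloor>(t - a) / (2 * pi)\<rfloor>"
  have m: "m \<le> (t - a) / (2 * pi)" "(t - a) / (2 * pi) < m + 1"
    unfolding m_def by linarith+
  show ?thesis
  proof (rule that[of "t - 2 * pi * m"])
    show "a \<le> t - 2 * pi * m" "t - 2 * pi * m < a + 2 * pi"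
      using m by (simp_all add: field_simps)
    have "sin (2 * pi * m) = 0" "cos (2 * pi * m) = 1"
      by (simp_all add: sin_int_2pin cos_int_2pin)
    then show "q = (cos (t - 2 * pi * m), sin (t - 2 * pi * m))"
      using t by (simp add: prod_eq_iff cos_diff sin_diff)
  qed
qed

lemma orient_circle_eq_0:
  assumes "(fst a)\<^sup>2 + (snd a)\<^sup>2 = 1" "(fst b)\<^sup>2 + (snd b)\<^sup>2 = 1" "(fst c)\<^sup>2 + (snd c)\<^sup>2 = 1"
    and "orient a b c = 0" "a \<noteq> b"
  shows "c = a \<or> c = b"
proof -
  obtain ta where ta: "a = (cos ta, sin ta)" using circle_angle_from[OF assms(1)] by blast
  obtain tb where tb: "ta \<le> tb" "tb < ta + 2 * pi" "b = (cos tb, sin tb)"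
    using circle_angle_from[OF assms(2)] by blast
  obtain tc where tc: "ta \<le> tc" "tc < ta + 2 * pi" "c = (cos tc, sin tc)"
    using circle_angle_from[OF assms(3)] by blast
  have "sgn (tb - ta) * sgn (tc - ta) * sgn (tc - tb) = 0"
    using sgn_orient_circle[of tb ta tc] assms(4) ta tb tc by auto
  then show ?thesis using ta tb tc assms(5) by (auto simp: sgn_0_0)
qed

text \<open>The part of the circle to the right of the directed chord is the counterclockwise arc
  from \<open>ta\<close> to \<open>tb\<close>: with \<open>tc\<close> measured from
  \<open>ta\<close>, a negative orientation forces \<open>tc\<close> to come before
  \<open>tb\<close>.\<close>

lemma arc_contains_side:
  assumes "ta < tb" "tb < ta + 2 * pi" "(fst c)\<^sup>2 + (snd c)\<^sup>2 = 1"
    and "orient (cos ta, sin ta) (cos tb, sin tb) c < 0"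
  obtains t where "ta \<le> t" "t \<le> tb" "c = (cos t, sin t)"
proof -
  obtain tc where tc: "ta \<le> tc" "tc < ta + 2 * pi" "c = (cos tc, sin tc)"
    using circle_angle_from[OF assms(3)] by blast
  have "sgn (tb - ta) * sgn (tc - ta) * sgn (tc - tb) = - 1"
    using sgn_orient_circle[of tb ta tc] assms tc by auto
  then have "tc \<le> tb" using assms tc by (auto simp: sgn_if split: if_splits)
  with tc show ?thesis using that by blast
qed

text \<open>The arc contains the whole piece of circle between the two angles, which is one complete
  side of the chord, and one of \<open>c\<close> and \<open>d\<close> lies on that side. Exchanging
  \<open>ta\<close> and \<open>tb\<close> flips both factors and preserves their product.\<close>

lemma arc_meets_opposite_sides:
  assumes "ta \<in> {\<alpha>..\<beta>}" "tb \<in> {\<alpha>..\<beta>}" "\<beta> < \<alpha> + 2 * pi"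
    and "(fst c)\<^sup>2 + (snd c)\<^sup>2 = 1" "(fst d)\<^sup>2 + (snd d)\<^sup>2 = 1"
    and "orient (cos ta, sin ta) (cos tb, sin tb) c *
      orient (cos ta, sin ta) (cos tb, sin tb) d < 0"
  shows "\<exists>t\<in>{\<alpha>..\<beta>}. (cos t, sin t) \<in> {c, d}"
  using assms
proof (induction ta tb rule: linorder_wlog)
  case (le ta tb)
  have "ta \<noteq> tb"
  proof
    assume "ta = tb"
    then show False using le.prems(6) by (simp add: orient_def)
  qed
  with le have lt: "ta < tb" "tb < ta + 2 * pi" by auto
  from le.prems(6) consider "orient (cos ta, sin ta) (cos tb, sin tb) c < 0"
    | "orient (cos ta, sin ta) (cos tb, sin tb) d < 0" by (auto simp: mult_less_0_iff)
  then show ?case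
  proof cases
    case 1
    from arc_contains_side[OF lt le.prems(4) 1] le.prems show ?thesis
      by (metis atLeastAtMost_iff insertI1 order_trans)
  next
    case 2
    from arc_contains_side[OF lt le.prems(5) 2] le.prems show ?thesis
      by (metis atLeastAtMost_iff insertI1 insertI2 order_trans)
  qed
next
  case (sym ta tb)
  show ?case
    by (rule sym.IH)
      (use sym.prems orient_swap[of "(cos ta, sin ta)" "(cos tb, sin tb)"] in auto)
qed

text \<open>The tangent at \<open>x\<close> has every other point of the circle strictly on its
  inner side, hence also the hull of those points.\<close>

lemma convex_position_circle:
  assumes "\<And>x. x \<in> S \<Longrightarrow> (fst x)\<^sup>2 + (snd x)\<^sup>2 = 1"
  shows "convex_position S"
  unfolding convex_position_def
proof
  fix x assume "x \<in> S"
  have "y \<bullet> x < 1" if "y \<in> S - {x}" for y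
  proof -
    \<comment> \<open>For unit vectors this squared distance is
      \<open>2 - 2 * (y \<bullet> x)\<close>.\<close>
    have "(fst x - fst y)\<^sup>2 + (snd x - snd y)\<^sup>2 > 0"
      using that by (auto simp: sum_power2_gt_zero_iff prod_eq_iff)
    then show ?thesis
      using assms[OF \<open>x \<in> S\<close>] assms[of y] that
      by (simp add: inner_prod_def power2_diff algebra_simps)
  qed
  then have "convex hull (S - {x}) \<subseteq> {y. x \<bullet> y < 1}"
    by (intro hull_minimal convex_halfspace_lt) (auto simp: inner_commute)
  moreover have "x \<bullet> x = 1"
    using assms[OF \<open>x \<in> S\<close>] by (simp add: inner_prod_def power2_eq_square)
  ultimately show "x \<notin> convex hull (S - {x})" by auto
qed

section \<open>Cylindrical representations\<close>

lemma mem_horizontal_segment: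
  assumes "0 \<le> (l :: real)"
  shows "(x, c) \<in> closed_segment (0, q) (l, q) \<longleftrightarrow> c = q \<and> 0 \<le> x \<and> x \<le> l"
proof
  assume "(x, c) \<in> closed_segment (0, q) (l, q)"
  then show "c = q \<and> 0 \<le> x \<and> x \<le> l"
    using assms by (auto simp: in_segment mult_left_le_one_le simp flip: scaleR_left_distrib)
next
  assume *: "c = q \<and> 0 \<le> x \<and> x \<le> l"
  have "\<exists>u\<ge>0. u \<le> 1 \<and> x = u * l"
    using * assms by (cases "l = 0") (auto intro: exI[of _ 0] exI[of _ "x / l"])
  then show "(x, c) \<in> closed_segment (0, q) (l, q)"
    using * by (auto simp: in_segment simp flip: scaleR_left_distrib)
qed

text \<open>Describes each bar by its position \<open>q v\<close> on the unit circle and its length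
  \<open>l v\<close>. Positions are distinct because bars at the same position would share their
  left endpoint.\<close>

lemma cylindrical_semi_bar_rep_coordinates:
  assumes "cylindrical_semi_bar_rep k V E s"
  obtains q and l :: "'a \<Rightarrow> real" where
    "\<And>v. v \<in> V \<Longrightarrow> (fst (q v))\<^sup>2 + (snd (q v))\<^sup>2 = 1"
    "\<And>v x c. v \<in> V \<Longrightarrow> (x, c) \<in> s v \<longleftrightarrow> c = q v \<and> 0 \<le> x \<and> x \<le> l v"
    "inj_on q V"
proof -
  have "\<exists>l q. 0 < l \<and> (fst q)\<^sup>2 + (snd q)\<^sup>2 = 1 \<and> s v = closed_segment (0, q) (l, q)"
    if "v \<in> V" for v
    using assms that unfolding cylindrical_semi_bar_rep_def semi_bar_def by force
  then obtain l q where lq: "\<And>v. v \<in> V \<Longrightarrow> 0 < l v \<and> (fst (q v))\<^sup>2 + (snd (q v))\<^sup>2 = 1 \<and>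
      s v = closed_segment (0, q v) (l v, q v)"
    by metis
  have mem: "(x, c) \<in> s v \<longleftrightarrow> c = q v \<and> 0 \<le> x \<and> x \<le> l v" if "v \<in> V" for v x c
    using lq[OF that] by (simp add: mem_horizontal_segment)
  have "inj_on q V"
  proof (rule inj_onI)
    fix u v assume uv: "u \<in> V" "v \<in> V" "q u = q v"
    then have "(0, q u) \<in> s u \<inter> s v" using lq[of u] lq[of v] by (simp add: mem)
    then show "u = v"
      using uv assms unfolding cylindrical_semi_bar_rep_def disjoint_family_on_def by blast
  qed
  with lq mem that show ?thesis by blast
qed

text \<open>The sightline lies at a height of at most \<open>min (l a) (l b)\<close>, which the bars
  of \<open>u\<close> and \<open>v\<close> both reach. It therefore meets either bar as soon as its
  arc passes the position of that bar.\<close>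

lemma sightline_meets_opposite_sides:
  assumes s: "\<And>v x c. v \<in> V \<Longrightarrow> (x, c) \<in> s v \<longleftrightarrow> c = q v \<and> 0 \<le> x \<and> x \<le> l v"
    and circle: "\<And>v. v \<in> V \<Longrightarrow> (fst (q v))\<^sup>2 + (snd (q v))\<^sup>2 = 1"
    and V: "a \<in> V" "b \<in> V" "u \<in> V" "v \<in> V"
    and A: "sightline A" "A \<inter> s a \<noteq> {}" "A \<inter> s b \<noteq> {}"
    and opp: "orient (q a) (q b) (q u) * orient (q a) (q b) (q v) < 0"
    and long: "min (l a) (l b) \<le> l u" "min (l a) (l b) \<le> l v"
  shows "\<exists>c\<in>{u, v}. A \<inter> s c \<noteq> {}"
proof -
  obtain x \<alpha> \<beta> where A': "\<beta> < \<alpha> + 2 * pi" "A = (\<lambda>t. (x, cos t, sin t)) ` {\<alpha>..\<beta>}"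
    using A(1) unfolding sightline_def by blast
  obtain ta tb where t: "ta \<in> {\<alpha>..\<beta>}" "(x, cos ta, sin ta) \<in> s a"
      "tb \<in> {\<alpha>..\<beta>}" "(x, cos tb, sin tb) \<in> s b"
    using A(2,3) unfolding A'(2) by blast
  then have ab: "q a = (cos ta, sin ta)" "q b = (cos tb, sin tb)" "0 \<le> x" "x \<le> min (l a) (l b)"
    using s V by auto
  obtain t where t': "t \<in> {\<alpha>..\<beta>}" "(cos t, sin t) \<in> {q u, q v}"
    using arc_meets_opposite_sides[OF t(1,3) A'(1) circle[OF V(3)] circle[OF V(4)]] opp ab by auto
  then obtain c where c: "c \<in> {u, v}" "(cos t, sin t) = q c" by blast
  then have "(x, cos t, sin t) \<in> s c" using V ab long by (auto simp: s)
  then show ?thesis using c t' unfolding A'(2) by blast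
qed

text \<open>The counting argument, shared by both claims of the theorem. The drawing uses the points
  \<open>P\<close> while visibility depends on the positions \<open>q\<close>; \<open>sep\<close>
  transfers crossings in the drawing to separation on the circle.\<close>

lemma no_pairwise_crossing_if_separating:
  fixes P :: "'a \<Rightarrow> real \<times> real"
  assumes E: "simple_graph V E" and rep: "cylindrical_semi_bar_rep k V E s"
    and s: "\<And>v x c. v \<in> V \<Longrightarrow> (x, c) \<in> s v \<longleftrightarrow> c = q v \<and> 0 \<le> x \<and> x \<le> l v"
    and circle: "\<And>v. v \<in> V \<Longrightarrow> (fst (q v))\<^sup>2 + (snd (q v))\<^sup>2 = 1"
    and sep: "\<And>a b u v. a \<in> V \<Longrightarrow> b \<in> V \<Longrightarrow> u \<in> V \<Longrightarrow> v \<in> V \<Longrightarrow> a \<noteq> b \<Longrightarrow> u \<noteq> v \<Longrightarrow>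
      closed_segment (P a) (P b) \<noteq> closed_segment (P u) (P v) \<Longrightarrow>
      segments_cross (closed_segment (P a) (P b)) (closed_segment (P u) (P v)) \<Longrightarrow>
      orient (q a) (q b) (q u) * orient (q a) (q b) (q v) < 0"
  shows "no_pairwise_crossing (k + 2) {closed_segment (P u) (P v) | u v. {u, v} \<in> E}"
  unfolding no_pairwise_crossing_def
proof
  assume "\<exists>F\<subseteq>{closed_segment (P u) (P v) | u v. {u, v} \<in> E}.
    card F = k + 2 \<and> pairwise segments_cross F"
  then obtain F where F: "F \<subseteq> {closed_segment (P u) (P v) | u v. {u, v} \<in> E}"
      "card F = k + 2" "pairwise segments_cross F"
    by blast
  have "\<exists>u v. {u, v} \<in> E \<and> f = closed_segment (P u) (P v)" if "f \<in> F" for f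
    using F(1) that by blast
  then obtain a b where ab: "\<And>f. f \<in> F \<Longrightarrow> {a f, b f} \<in> E"
      "\<And>f. f \<in> F \<Longrightarrow> f = closed_segment (P (a f)) (P (b f))"
    by metis
  have V: "a f \<in> V" "b f \<in> V" "a f \<noteq> b f" if "f \<in> F" for f
    using E ab(1)[OF that] unfolding simple_graph_def by fastforce+
  have opp: "orient (q (a f)) (q (b f)) (q (a g)) * orient (q (a f)) (q (b f)) (q (b g)) < 0"
    if "f \<in> F" "g \<in> F" "f \<noteq> g" for f g
    using sep[of "a f" "b f" "a g" "b g"] V[of f] V[of g] ab(2)[of f] ab(2)[of g] F(3) that
    by (auto simp: pairwise_def)
  \<comment> \<open>A shared endpoint would make one factor in \<open>opp\<close> zero.\<close>
  have distinct: "{a f, b f} \<inter> {a g, b g} = {}" if "f \<in> F" "g \<in> F" "f \<noteq> g" for f g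
    using opp[OF that] by auto
  have "finite F" "F \<noteq> {}" using F(2) card.infinite by fastforce+
  \<comment> \<open>The chord \<open>e\<close> carries the shortest bar among all endpoints of
    \<open>F\<close>.\<close>
  then obtain e where e: "e \<in> F"
      "\<And>f. f \<in> F \<Longrightarrow> min (l (a e)) (l (b e)) \<le> min (l (a f)) (l (b f))"
    using ex_is_arg_min_if_finite[of F "\<lambda>f. min (l (a f)) (l (b f))"]
    by (auto simp: is_arg_min_linorder)
  have "k_visible k V s (a e) (b e)"
    using rep V[OF e(1)] ab(1)[OF e(1)] unfolding cylindrical_semi_bar_rep_def by blast
  then obtain A where A: "sightline A" "A \<inter> s (a e) \<noteq> {}" "A \<inter> s (b e) \<noteq> {}"
      "card {c \<in> V - {a e, b e}. A \<inter> s c \<noteq> {}} \<le> k"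
    unfolding k_visible_def by blast
  have "\<exists>c\<in>{a f, b f}. A \<inter> s c \<noteq> {}" if "f \<in> F - {e}" for f
  proof (rule sightline_meets_opposite_sides[OF s circle])
    show "orient (q (a e)) (q (b e)) (q (a f)) * orient (q (a e)) (q (b e)) (q (b f)) < 0"
      using opp[of e f] that e(1) by blast
    show "min (l (a e)) (l (b e)) \<le> l (a f)" "min (l (a e)) (l (b e)) \<le> l (b f)"
      using e(2)[of f] that by auto
  qed (use that V e(1) A in blast)+
  then obtain c where c: "\<And>f. f \<in> F - {e} \<Longrightarrow> c f \<in> {a f, b f} \<and> A \<inter> s (c f) \<noteq> {}"
    by metis
  have "inj_on c (F - {e})"
    using c distinct by (intro inj_onI) (metis DiffD1 disjoint_iff)
  then have "card (F - {e}) = card (c ` (F - {e}))" by (simp add: card_image)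
  also have "\<dots> \<le> card {c \<in> V - {a e, b e}. A \<inter> s c \<noteq> {}}"
  proof (rule card_mono)
    show "c ` (F - {e}) \<subseteq> {c \<in> V - {a e, b e}. A \<inter> s c \<noteq> {}}"
    proof
      fix x assume "x \<in> c ` (F - {e})"
      then obtain f where f: "f \<in> F - {e}" "x = c f" by blast
      then have fF: "f \<in> F" "e \<noteq> f" by blast+
      have cf: "c f \<in> {a f, b f}" "A \<inter> s (c f) \<noteq> {}" using c[OF f(1)] by blast+
      have "c f \<in> V" using cf(1) V(1,2)[OF fF(1)] by auto
      moreover have "c f \<notin> {a e, b e}" using cf(1) distinct[OF e(1) fF] by auto
      ultimately show "x \<in> {c \<in> V - {a e, b e}. A \<inter> s c \<noteq> {}}"
        using f(2) cf(2) by simp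
    qed
  qed (use E in \<open>simp add: simple_graph_def\<close>)
  also have "\<dots> \<le> k" by (fact A(4))
  \<comment> \<open>The set \<open>F - {e}\<close> has \<open>k + 1\<close> elements, one more than
    the sightline allows.\<close>
  finally show False using F(2) e(1) \<open>finite F\<close> by simp
qed

text \<open>Both point sets have the same cyclic order, so the index arcs cut off by
  \<open>i\<close> and \<open>j\<close> describe the sides of the chord in either one. The
  reflection \<open>\<sigma>\<close> changes both signs together.\<close>

lemma cyclic_order_separates_bars:
  fixes \<theta> :: "nat \<Rightarrow> real"
  assumes p: "convex_position_in_cyclic_order n p"
    and \<theta>: "strict_mono_on {..<n} \<theta>" "\<And>i. i < n \<Longrightarrow> \<theta> i < \<theta> 0 + 2 * pi"
    and \<sigma>: "\<sigma> \<in> {1, - 1 :: real}"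
    and lt: "i < n" "j < n" "u < n" "v < n" and ne: "i \<noteq> j" "u \<noteq> v"
    and neq: "closed_segment (p i) (p j) \<noteq> closed_segment (p u) (p v)"
    and cross: "segments_cross (closed_segment (p i) (p j)) (closed_segment (p u) (p v))"
  defines "q \<equiv> \<lambda>i. (cos (\<theta> i), \<sigma> * sin (\<theta> i))"
  shows "orient (q i) (q j) (q u) * orient (q i) (q j) (q v) < 0"
  using lt(1,2) ne(1) neq cross
proof (induction i j rule: linorder_wlog)
  case (le i j)
  then have ij: "i < j" by simp
  have inj: "inj_on p {..<n}" and S: "convex_position (p ` {..<n})"
    using p by (auto simp: convex_position_in_cyclic_order_def)
  have pne: "p i \<noteq> p j" "p u \<noteq> p v"
    using inj le ne lt by (auto dest: inj_onD)
  \<comment> \<open>Two zeros would make both chords join the same two points, against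
    \<open>neq\<close>.\<close>
  have "\<not> (orient (p i) (p j) (p u) = 0 \<and> orient (p i) (p j) (p v) = 0)"
  proof
    assume "orient (p i) (p j) (p u) = 0 \<and> orient (p i) (p j) (p v) = 0"
    then have "p u \<in> {p i, p j}" "p v \<in> {p i, p j}"
      using convex_position_not_collinear[OF S, of "p i" "p j"] le lt pne by blast+
    then show False using pne le.prems(4) by (auto simp: closed_segment_commute)
  qed
  then have "orient (p i) (p j) (p u) * orient (p i) (p j) (p v) < 0"
    using orient_crossing[OF le.prems(5) pne] by blast
  then have split: "(u \<in> {i<..<j} \<and> v \<in> {..<i} \<union> {j<..}) \<or> (v \<in> {i<..<j} \<and> u \<in> {..<i} \<union> {j<..})"
    using convex_position_cyclic_separates[OF p ij] le lt by blast
  have mono: "\<theta> x < \<theta> y" if "x < y" "y < n" for x y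
    using \<theta>(1) that by (auto simp: strict_mono_on_def)
  have diff: "\<bar>\<theta> x - \<theta> y\<bar> < 2 * pi" if "x < n" "y < n" for x y
    using \<theta>(2)[OF that(1)] \<theta>(2)[OF that(2)] mono[of 0 x] mono[of 0 y] that
    by (cases "x = 0"; cases "y = 0") auto
  have orient_q: "orient (q i) (q j) (q m) =
      \<sigma> * orient (cos (\<theta> i), sin (\<theta> i)) (cos (\<theta> j), sin (\<theta> j)) (cos (\<theta> m), sin (\<theta> m))" for m
    by (simp add: orient_def q_def algebra_simps)
  \<comment> \<open>The remaining factor \<open>sgn (\<theta> j - \<theta> i)\<close> is 1 because
    \<open>i < j\<close>.\<close>
  have sgn_q: "sgn (orient (q i) (q j) (q m)) = \<sigma> * (sgn (\<theta> m - \<theta> i) * sgn (\<theta> m - \<theta> j))"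
    if "m < n" for m
    using sgn_orient_circle[of "\<theta> j" "\<theta> i" "\<theta> m"] diff that le.prems mono[OF ij] \<sigma>
    by (auto simp: orient_q sgn_mult)
  have inside: "sgn (orient (q i) (q j) (q m)) = - \<sigma>" if "m \<in> {i<..<j}" for m
    using sgn_q[of m] mono[of i m] mono[of m j] that le.prems by auto
  have outside: "sgn (orient (q i) (q j) (q m)) = \<sigma>" if "m \<in> {..<i} \<union> {j<..}" "m < n" for m
    using sgn_q[of m] mono[of m i] mono[of i j] mono[of m j] mono[of i m] mono[of j m] that le.prems ij
    by auto
  have "sgn (orient (q i) (q j) (q u) * orient (q i) (q j) (q v)) < 0"
    unfolding sgn_mult using split inside outside lt \<sigma> by auto
  then show ?case unfolding sgn_less .
next
  case (sym i j)
  then show ?case by (simp add: orient_swap[of "q i" "q j"] closed_segment_commute)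
qed

theorem theorem1:
  fixes k :: nat and V :: "'a set" and E :: "'a set set"
  assumes "simple_graph V E"
  shows "(cylindrical_semi_bar_graph k V E \<longrightarrow> quasiplanar_convex_geometric (k + 2) V E) \<and>
    (\<forall>s n w p.
       cylindrical_semi_bar_rep k V E s \<longrightarrow>
       bars_in_cyclic_order V s n w \<longrightarrow>
       convex_position_in_cyclic_order n p \<longrightarrow>
       no_pairwise_crossing (k + 2)
         {closed_segment (p i) (p j) | i j. i < n \<and> j < n \<and> {w i, w j} \<in> E})"
proof (intro conjI impI allI)
  assume "cylindrical_semi_bar_graph k V E"
  then obtain s where rep: "cylindrical_semi_bar_rep k V E s"
    unfolding cylindrical_semi_bar_graph_def by blast
  obtain q l where q: "\<And>v. v \<in> V \<Longrightarrow> (fst (q v))\<^sup>2 + (snd (q v))\<^sup>2 = 1"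
      "\<And>v x c. v \<in> V \<Longrightarrow> (x, c) \<in> s v \<longleftrightarrow> c = q v \<and> 0 \<le> x \<and> x \<le> l v" "inj_on q V"
    by (rule cylindrical_semi_bar_rep_coordinates[OF rep]) (rule that)
  \<comment> \<open>The vertices are drawn at the positions of their own bars on the unit
    circle.\<close>
  have "no_pairwise_crossing (k + 2) {closed_segment (q u) (q v) | u v. {u, v} \<in> E}"
  proof (rule no_pairwise_crossing_if_separating[OF assms rep q(2,1)])
    fix a b u v
    assume V: "a \<in> V" "b \<in> V" "u \<in> V" "v \<in> V" and "a \<noteq> b" "u \<noteq> v"
      and neq: "closed_segment (q a) (q b) \<noteq> closed_segment (q u) (q v)"
      and cross: "segments_cross (closed_segment (q a) (q b)) (closed_segment (q u) (q v))"
    then have ne: "q a \<noteq> q b" "q u \<noteq> q v" using q(3) by (auto dest: inj_onD)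
    have "\<not> (orient (q a) (q b) (q u) = 0 \<and> orient (q a) (q b) (q v) = 0)"
    proof
      assume "orient (q a) (q b) (q u) = 0 \<and> orient (q a) (q b) (q v) = 0"
      then have "q u \<in> {q a, q b}" "q v \<in> {q a, q b}"
        using orient_circle_eq_0[of "q a" "q b"] q(1) V ne by auto
      then show False using ne neq by (auto simp: closed_segment_commute)
    qed
    then show "orient (q a) (q b) (q u) * orient (q a) (q b) (q v) < 0"
      using orient_crossing[OF cross ne] by blast
  qed
  moreover have "convex_position (q ` V)" using q(1) by (intro convex_position_circle) auto
  ultimately show "quasiplanar_convex_geometric (k + 2) V E"
    using q(3) unfolding quasiplanar_convex_geometric_def by blast
next
  fix s n w p
  assume rep: "cylindrical_semi_bar_rep k V E s" and bars: "bars_in_cyclic_order V s n w"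
    and p: "convex_position_in_cyclic_order n p"
  obtain q l where q: "\<And>v. v \<in> V \<Longrightarrow> (fst (q v))\<^sup>2 + (snd (q v))\<^sup>2 = 1"
      "\<And>v x c. v \<in> V \<Longrightarrow> (x, c) \<in> s v \<longleftrightarrow> c = q v \<and> 0 \<le> x \<and> x \<le> l v" "inj_on q V"
    by (rule cylindrical_semi_bar_rep_coordinates[OF rep]) (rule that)
  obtain \<theta> \<sigma> where w: "bij_betw w {..<n} V" and \<sigma>: "\<sigma> \<in> {1, - 1 :: real}"
    and \<theta>: "strict_mono_on {..<n} \<theta>" "\<And>i. i < n \<Longrightarrow> \<theta> i < \<theta> 0 + 2 * pi"
      "\<And>i. i < n \<Longrightarrow> (0, cos (\<theta> i), \<sigma> * sin (\<theta> i)) \<in> s (w i)"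
    using bars unfolding bars_in_cyclic_order_def by blast
  have wV: "w i \<in> V" if "i < n" for i using w that by (auto dest: bij_betwE)
  have qw: "q (w i) = (cos (\<theta> i), \<sigma> * sin (\<theta> i))" if "i < n" for i
    using \<theta>(3)[OF that] q(2)[OF wV[OF that]] by simp
  \<comment> \<open>The place of a vertex in the cyclic order; composing \<open>p\<close> with
    \<open>r\<close> gives a drawing indexed by vertices.\<close>
  define r where "r = the_inv_into {..<n} w"
  have r: "r v < n" "w (r v) = v" if "v \<in> V" for v
    using w that the_inv_into_into[of w "{..<n}" v] f_the_inv_into_f_bij_betw[of w "{..<n}" V v]
    by (auto simp: r_def bij_betw_def)
  have rw: "r (w i) = i" if "i < n" for i
    using w that by (auto simp: r_def bij_betw_def the_inv_into_f_f)
  have "no_pairwise_crossing (k + 2) {closed_segment (p (r u)) (p (r v)) | u v. {u, v} \<in> E}"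
  proof (rule no_pairwise_crossing_if_separating[OF assms rep q(2,1)])
    fix a b u v
    assume V: "a \<in> V" "b \<in> V" "u \<in> V" "v \<in> V" and "a \<noteq> b" "u \<noteq> v"
      and neq: "closed_segment (p (r a)) (p (r b)) \<noteq> closed_segment (p (r u)) (p (r v))"
      and cross: "segments_cross (closed_segment (p (r a)) (p (r b)))
        (closed_segment (p (r u)) (p (r v)))"
    then have ne: "r a \<noteq> r b" "r u \<noteq> r v" using r(2) by metis+
    show "orient (q a) (q b) (q u) * orient (q a) (q b) (q v) < 0"
      using cyclic_order_separates_bars[OF p \<theta>(1,2) \<sigma> r(1)[OF V(1)] r(1)[OF V(2)] r(1)[OF V(3)]
          r(1)[OF V(4)] ne neq cross] qw[of "r a"] qw[of "r b"] qw[of "r u"] qw[of "r v"] r V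
      by simp
  qed
  moreover have "{closed_segment (p i) (p j) | i j. i < n \<and> j < n \<and> {w i, w j} \<in> E} =
      {closed_segment (p (r u)) (p (r v)) | u v. {u, v} \<in> E}" (is "?L = ?R")
  proof
    show "?L \<subseteq> ?R"
    proof
      fix e assume "e \<in> ?L"
      then obtain i j where ij: "i < n" "j < n" "{w i, w j} \<in> E" "e = closed_segment (p i) (p j)"
        by blast
      then have "e = closed_segment (p (r (w i))) (p (r (w j)))" by (simp add: rw)
      with ij(3) show "e \<in> ?R" by blast
    qed
    show "?R \<subseteq> ?L"
    proof
      fix e assume "e \<in> ?R"
      then obtain u v where uv: "{u, v} \<in> E" "e = closed_segment (p (r u)) (p (r v))" by blast
      then have "u \<in> V" "v \<in> V" using assms by (auto simp: simple_graph_def)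
      with uv r[of u] r[of v] show "e \<in> ?L" by force
    qed
  qed
  ultimately show "no_pairwise_crossing (k + 2)
      {closed_segment (p i) (p j) | i j. i < n \<and> j < n \<and> {w i, w j} \<in> E}"
    by simp
qed

end
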